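(* Let $G_1,G_2,\ldots,G_n$ be a finite sequence of pairwise disjoint connected graphs and let $x_i,y_i\in V(G_i)$ for $1\le i\le n$. Let $G$ be the link of the graphs $\{G_i\}_{i=1}^n$ with respect to the vertices $\{x_i,y_i\}_{i=1}^n$. Then $$ABC_{GG}(G)<\Big(|E(G)|-(n-1)\Big)+\sum_{i=1}^{n}ABC_{GG}(G_i)+\sum_{i=1}^{n-1}\sqrt{\frac{|V(G)|-2}{\left(\sum_{t=1}^{i}|V(G_t)|\right)\left(\sum_{t=i+1}^{n}|V(G_t)|\right)}}.$$
   Context: All graphs are finite and simple. For an edge $uv$ of a graph $G$, $n_u(uv,G)$ is the number of vertices of $G$ strictly closer (in graph distance in $G$) to $u$ than to $v$, and $n_v(uv,G)$ is defined analogously; equidistant vertices are not counted. $ABC_{GG}(G)=\sum_{uv\in E(G)}\sqrt{\frac{n_u(uv,G)+n_v(uv,G)-2}{n_u(uv,G)n_v(uv,G)}}$ (Graovac-Ghorbani index). The link of $\{G_i\}_{i=1}^n$ with respect to $\{x_i,y_i\}_{i=1}^n$ is the graph obtained from the disjoint union of $G_1,\ldots,G_n$ by adding the edge $y_ix_{i+1}$ for each $i=1,\ldots,n-1$.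
   Formalization: The formal theorem additionally assumes that at least one G_i has an edge; if every G_i is a single vertex, G is a path and both sides are equal, so the strict inequality fails in exactly that case. *)

theory Defs
  imports Complex_Main "HOL-Library.Extended_Nat" "HOL-Library.Disjoint_Sets"
begin

datatype 'a graph = Graph (verts: "'a set") (edges: "'a set set")

definition simple_graph :: "'a graph \<Rightarrow> bool" where
  "simple_graph G \<longleftrightarrow> finite (verts G) \<and> (\<forall>e\<in>edges G. e \<subseteq> verts G \<and> card e = 2)"

definition walks :: "'a graph \<Rightarrow> 'a \<Rightarrow> 'a \<Rightarrow> 'a list set" where
  "walks G u v = {p. p \<noteq> [] \<and> hd p = u \<and> last p = v \<and> set p \<subseteq> verts G
                    \<and> successively (\<lambda>a b. {a, b} \<in> edges G) p}"

definition connected_graph :: "'a graph \<Rightarrow> bool" where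
  "connected_graph G \<longleftrightarrow> verts G \<noteq> {} \<and> (\<forall>u\<in>verts G. \<forall>v\<in>verts G. walks G u v \<noteq> {})"

text \<open>Walks are vertex lists, so a walk \<open>p\<close> has \<open>length p - 1\<close> edges. The distance is
  \<open>\<infinity>\<close> between vertices that are not joined by a walk.\<close>
definition gdist :: "'a graph \<Rightarrow> 'a \<Rightarrow> 'a \<Rightarrow> enat" where
  "gdist G u v = (INF p\<in>walks G u v. enat (length p - 1))"

text \<open>\<open>n_closer G u v\<close> is $n_u(uv,G)$; hence \<open>n_closer G v u\<close> is $n_v(uv,G)$.\<close>
definition n_closer :: "'a graph \<Rightarrow> 'a \<Rightarrow> 'a \<Rightarrow> nat" where
  "n_closer G u v = card {w \<in> verts G. gdist G w u < gdist G w v}"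

text \<open>The summand is symmetric in \<open>u\<close> and \<open>v\<close>, so it is determined by the unordered edge;
  see \<open>gg_weight_edge\<close>.\<close>
definition gg_weight :: "'a graph \<Rightarrow> 'a set \<Rightarrow> real" where
  "gg_weight G e = (THE r. \<exists>u v. e = {u, v} \<and>
     r = sqrt ((real (n_closer G u v) + real (n_closer G v u) - 2)
                / (real (n_closer G u v) * real (n_closer G v u))))"

lemma gg_weight_edge:
  "gg_weight G {u, v} =
     sqrt ((real (n_closer G u v) + real (n_closer G v u) - 2)
            / (real (n_closer G u v) * real (n_closer G v u)))"
  unfolding gg_weight_def
  by (rule the_equality) (auto simp: doubleton_eq_iff add.commute mult.commute)

definition ABC_GG :: "'a graph \<Rightarrow> real" where
  "ABC_GG G = (\<Sum>e\<in>edges G. gg_weight G e)"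

text \<open>The vertex sets of \<open>Gs 1, \<dots>, Gs n\<close> are meant to be pairwise disjoint, so that
  the disjoint union is the plain union.\<close>
definition graph_link :: "nat \<Rightarrow> (nat \<Rightarrow> 'a graph) \<Rightarrow> (nat \<Rightarrow> 'a) \<Rightarrow> (nat \<Rightarrow> 'a) \<Rightarrow> 'a graph" where
  "graph_link n Gs x y =
     Graph (\<Union>i\<in>{1..n}. verts (Gs i))
           ((\<Union>i\<in>{1..n}. edges (Gs i)) \<union> (\<lambda>i. {y i, x (i + 1)}) ` {1..n - 1})"

end

theory Submission
  imports Defs
begin

text \<open>
  Every edge contributes less than \<open>1\<close> to the index, because
  \<open>(a + b - 2) / (a * b) = 1 - ((a - 1) * (b - 1) + 1) / (a * b)\<close> for \<open>a, b \<ge> 1\<close>, and no edge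
  contributes a negative amount (\<open>gg_weight_bounds\<close>). Hence the edges lying inside the parts together contribute
  less than their number, and strictness comes from there being at least one of them; the sum of
  the \<open>ABC_GG (Gs i)\<close> on the right-hand side only adds something nonnegative.

  The linking edges, on the other hand, are accounted for exactly. The edge from \<open>y i\<close> to
  \<open>x (i + 1)\<close> is the only one between the first \<open>i\<close> parts and the remaining ones, so every walk
  crossing over runs along it. A vertex is therefore closer to the end on its own side
  (\<open>n_closer_bridge\<close>), and the two closeness counts are the sizes of the two sides. This
  makes the weight of the edge equal to the \<open>i\<close>-th square root in the bound.

  It remains to count: the linking edges are \<open>n - 1\<close> different edges outside the parts, so the
  edges inside the parts number \<open>|E(G)| - (n - 1)\<close>.
\<close>

section \<open>The weight of an edge lies in [0, 1)\<close>

text \<open>If one of the counts is \<open>0\<close>, the quotient is \<open>0\<close> by the convention for division by zero, so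
  the bounds hold for arbitrary pairs of vertices.\<close>

lemma gg_weight_bounds:
  assumes "card e = 2"
  shows "0 \<le> gg_weight G e" and "gg_weight G e < 1"
proof -
  obtain u v where e: "e = {u, v}"
    using assms by (auto simp: card_2_iff)
  define a b where "a = n_closer G u v" and "b = n_closer G v u"
  have w: "gg_weight G e = sqrt ((real a + real b - 2) / (real a * real b))"
    unfolding e a_def b_def by (rule gg_weight_edge)
  have "0 \<le> gg_weight G e \<and> gg_weight G e < 1"
  proof (cases "a = 0 \<or> b = 0")
    case True
    then show ?thesis using w by auto
  next
    case False
    then have ge: "real a \<ge> 1" "real b \<ge> 1" by auto
    then have "0 \<le> (real a - 1) * (real b - 1)" by simp
    then have "real a + real b - 2 < real a * real b" by (simp add: algebra_simps)
    then have "(real a + real b - 2) / (real a * real b) < 1"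
      using ge by (simp add: divide_simps)
    moreover have "0 \<le> (real a + real b - 2) / (real a * real b)" using ge by simp
    ultimately show ?thesis unfolding w by simp
  qed
  then show "0 \<le> gg_weight G e" "gg_weight G e < 1" by auto
qed

lemma ABC_GG_nonneg:
  assumes "simple_graph G"
  shows "0 \<le> ABC_GG G"
  unfolding ABC_GG_def
  by (rule sum_nonneg) (use assms in \<open>auto simp: simple_graph_def intro: gg_weight_bounds\<close>)

lemma simple_graph_finite_edges:
  assumes "simple_graph G"
  shows "finite (edges G)"
proof (rule finite_subset)
  show "edges G \<subseteq> Pow (verts G)" using assms by (auto simp: simple_graph_def)
  show "finite (Pow (verts G))" using assms by (simp add: simple_graph_def)
qed

section \<open>Walks\<close>

lemma walks_mono:
  assumes "verts H \<subseteq> verts G" and "edges H \<subseteq> edges G" and "walks H u v \<noteq> {}"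
  shows "walks G u v \<noteq> {}"
proof -
  obtain p where "p \<in> walks H u v" using assms(3) by blast
  then have "p \<in> walks G u v"
    using assms(1,2) by (auto simp: walks_def elim!: successively_mono)
  then show ?thesis by blast
qed

lemma walks_sym:
  assumes "walks G u v \<noteq> {}"
  shows "walks G v u \<noteq> {}"
proof -
  obtain p where "p \<in> walks G u v" using assms by blast
  then have "rev p \<in> walks G v u"
    by (auto simp: walks_def hd_rev last_rev successively_rev insert_commute)
  then show ?thesis by blast
qed

lemma walks_trans:
  assumes "walks G u v \<noteq> {}" and "walks G v w \<noteq> {}"
  shows "walks G u w \<noteq> {}"
proof -
  obtain p q where p: "p \<in> walks G u v" and q: "q \<in> walks G v w" using assms by blast
  show ?thesis
  proof (cases "tl q = []")
    case True
    then have "v = w" using q by (cases q) (auto simp: walks_def)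
    then show ?thesis using p by blast
  next
    case False
    have "q = v # tl q" using q by (cases q) (auto simp: walks_def)
    (* Dropping the head of q keeps the joint vertex v from being repeated. *)
    then have "p @ tl q \<in> walks G u w"
      using p q False unfolding walks_def
      by (cases q) (auto simp: successively_append_iff successively_Cons last_append)
    then show ?thesis by blast
  qed
qed

lemma walks_edge:
  assumes "{u, v} \<in> edges G" and "u \<in> verts G" and "v \<in> verts G"
  shows "walks G u v \<noteq> {}"
proof -
  have "[u, v] \<in> walks G u v" using assms by (simp add: walks_def)
  then show ?thesis by blast
qed

section \<open>Closeness across a bridge\<close>

text \<open>A walk that changes sides has to visit the near end of the bridge before it can reach the
  far end; cutting it off there makes it shorter.\<close>

lemma walk_to_near_end_shorter:
  assumes "\<And>a b. a \<in> L \<Longrightarrow> b \<in> R \<Longrightarrow> {a, b} \<in> edges G \<Longrightarrow> a = u \<and> b = v"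
    and "verts G = L \<union> R" and "L \<inter> R = {}" and "v \<in> R"
  shows "p \<in> walks G w v \<Longrightarrow> w \<in> L \<Longrightarrow> \<exists>q\<in>walks G w u. length q < length p"
proof (induction p arbitrary: w)
  case Nil
  then show ?case by (simp add: walks_def)
next
  case (Cons a p)
  have [simp]: "a = w" using Cons.prems by (simp add: walks_def)
  have "w \<noteq> v" using Cons.prems assms by auto
  then have p: "p \<noteq> []" using Cons.prems by (auto simp: walks_def)
  define w' where "w' = hd p"
  have edge: "{w, w'} \<in> edges G" and p': "p \<in> walks G w' v" and w: "w \<in> verts G"
    using Cons.prems p by (auto simp: walks_def successively_Cons w'_def)
  have "w' \<in> verts G" using p p' hd_in_set[OF p] by (auto simp: walks_def)
  then consider "w' \<in> L" | "w' \<in> R" using assms(2) by blast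
  then show ?case
  proof cases
    case 1
    then obtain q where q: "q \<in> walks G w' u" "length q < length p"
      using Cons.IH[OF p'] by blast
    have "w # q \<in> walks G w u"
      using q(1) edge w by (auto simp: walks_def successively_Cons)
    then show ?thesis using q(2) by (intro bexI[of _ "w # q"]) simp_all
  next
    case 2
    then have "w = u" using assms(1)[OF Cons.prems(2) 2 edge] by simp
    then have "[w] \<in> walks G w u" using w by (simp add: walks_def)
    then show ?thesis using p by (intro bexI[of _ "[w]"]) simp_all
  qed
qed

lemma gdist_near_end_less:
  assumes "\<And>a b. a \<in> L \<Longrightarrow> b \<in> R \<Longrightarrow> {a, b} \<in> edges G \<Longrightarrow> a = u \<and> b = v"
    and "verts G = L \<union> R" and "L \<inter> R = {}" and "v \<in> R"
    and "walks G w v \<noteq> {}" and "w \<in> L"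
  shows "gdist G w u < gdist G w v"
proof -
  (* Infima over nonempty sets are attained in enat: take a shortest walk p. *)
  obtain p0 where "p0 \<in> walks G w v" using assms(5) by blast
  then have "gdist G w v \<in> (\<lambda>p. enat (length p - 1)) ` walks G w v"
    unfolding gdist_def by (rule wellorder_InfI[OF imageI])
  then obtain p where p: "p \<in> walks G w v" "gdist G w v = enat (length p - 1)" by auto
  obtain q where q: "q \<in> walks G w u" "length q < length p"
    using walk_to_near_end_shorter[OF assms(1-4) p(1) assms(6)] by blast
  have "gdist G w u \<le> enat (length q - 1)"
    unfolding gdist_def by (rule INF_lower[OF q(1)])
  also have "\<dots> < gdist G w v"
    using q by (cases q) (auto simp: p(2) walks_def)
  finally show ?thesis .
qed

text \<open>Connectedness matters here: it makes the distance to the far end finite, whereas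
  two infinite distances would leave the vertex uncounted.\<close>

lemma n_closer_bridge:
  assumes cut: "\<And>a b. a \<in> L \<Longrightarrow> b \<in> R \<Longrightarrow> {a, b} \<in> edges G \<Longrightarrow> a = u \<and> b = v"
    and V: "verts G = L \<union> R" "L \<inter> R = {}" and uv: "u \<in> L" "v \<in> R"
    and conn: "connected_graph G"
  shows "n_closer G u v = card L" and "n_closer G v u = card R"
proof -
  have L: "gdist G w u < gdist G w v" if "w \<in> L" for w
  proof (rule gdist_near_end_less[OF cut V uv(2) _ that])
    show "walks G w v \<noteq> {}" using conn that uv V by (auto simp: connected_graph_def)
  qed
  have cut': "a = v \<and> b = u" if "a \<in> R" "b \<in> L" "{a, b} \<in> edges G" for a b
    using cut[of b a] that by (simp add: insert_commute)
  have V': "verts G = R \<union> L" "R \<inter> L = {}" using V by auto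
  have R: "gdist G w v < gdist G w u" if "w \<in> R" for w
  proof (rule gdist_near_end_less[OF cut' V' uv(1) _ that])
    show "walks G w u \<noteq> {}" using conn that uv V by (auto simp: connected_graph_def)
  qed
  have "{w \<in> verts G. gdist G w u < gdist G w v} = L"
    using L R V by (auto dest: less_asym)
  then show "n_closer G u v = card L" by (simp add: n_closer_def)
  have "{w \<in> verts G. gdist G w v < gdist G w u} = R"
    using L R V by (auto dest: less_asym)
  then show "n_closer G v u = card R" by (simp add: n_closer_def)
qed

section \<open>The link of a sequence of graphs\<close>

lemma verts_graph_link: "verts (graph_link n Gs x y) = (\<Union>i\<in>{1..n}. verts (Gs i))"
  by (simp add: graph_link_def)

lemma edges_graph_link:
  "edges (graph_link n Gs x y) =
     (\<Union>i\<in>{1..n}. edges (Gs i)) \<union> (\<lambda>i. {y i, x (i + 1)}) ` {1..n - 1}"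
  by (simp add: graph_link_def)

lemma connected_graph_link:
  assumes n: "n \<ge> 1"
    and conn: "\<And>i. i \<in> {1..n} \<Longrightarrow> connected_graph (Gs i)"
    and xy: "\<And>i. i \<in> {1..n} \<Longrightarrow> x i \<in> verts (Gs i) \<and> y i \<in> verts (Gs i)"
  shows "connected_graph (graph_link n Gs x y)"
proof -
  let ?G = "graph_link n Gs x y"
  have part: "walks ?G a b \<noteq> {}" if "i \<in> {1..n}" "a \<in> verts (Gs i)" "b \<in> verts (Gs i)" for i a b
  proof (rule walks_mono)
    show "verts (Gs i) \<subseteq> verts ?G" "edges (Gs i) \<subseteq> edges ?G"
      using that(1) by (auto simp: verts_graph_link edges_graph_link)
    show "walks (Gs i) a b \<noteq> {}"
      using conn[OF that(1)] that(2,3) by (auto simp: connected_graph_def)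
  qed
  have base: "walks ?G (x 1) (x j) \<noteq> {}" if "1 \<le> j" "j \<le> n" for j
    using that
  proof (induction j rule: dec_induct)
    case base
    then show ?case using part[of 1 "x 1" "x 1"] xy[of 1] n by auto
  next
    case (step j)
    have j: "j \<in> {1..n}" "Suc j \<in> {1..n}" "j \<in> {1..n - 1}" using step by auto
    have "walks ?G (y j) (x (Suc j)) \<noteq> {}"
      using j xy[OF j(1)] xy[OF j(2)]
      by (intro walks_edge) (auto simp: verts_graph_link edges_graph_link)
    moreover have "walks ?G (x j) (y j) \<noteq> {}" using part[OF j(1)] xy[OF j(1)] by blast
    moreover have "walks ?G (x 1) (x j) \<noteq> {}" using step by simp
    ultimately show ?case using walks_trans[of ?G] by meson
  qed
  have reach: "walks ?G (x 1) a \<noteq> {}" if a: "a \<in> verts ?G" for a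
  proof -
    obtain i where i: "i \<in> {1..n}" "a \<in> verts (Gs i)"
      using a unfolding verts_graph_link by blast
    have "walks ?G (x 1) (x i) \<noteq> {}" using base i by simp
    moreover have "walks ?G (x i) a \<noteq> {}" using part[OF i(1) _ i(2)] xy[OF i(1)] by blast
    ultimately show ?thesis by (rule walks_trans)
  qed
  have "x 1 \<in> verts ?G" using xy[of 1] n by (auto simp: verts_graph_link)
  moreover have "walks ?G a b \<noteq> {}" if "a \<in> verts ?G" "b \<in> verts ?G" for a b
    using walks_trans[OF walks_sym[OF reach[OF that(1)]] reach[OF that(2)]] .
  ultimately show ?thesis unfolding connected_graph_def by blast
qed

theorem theorem2p7:
  fixes n :: nat and Gs :: "nat \<Rightarrow> 'a graph" and x y :: "nat \<Rightarrow> 'a" and G :: "'a graph"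
  assumes "n \<ge> 1"
    and "\<And>i. i \<in> {1..n} \<Longrightarrow> simple_graph (Gs i)"
    and "\<And>i. i \<in> {1..n} \<Longrightarrow> connected_graph (Gs i)"
    and "disjoint_family_on (\<lambda>i. verts (Gs i)) {1..n}"
    and "\<And>i. i \<in> {1..n} \<Longrightarrow> x i \<in> verts (Gs i) \<and> y i \<in> verts (Gs i)"
    and "\<exists>i\<in>{1..n}. edges (Gs i) \<noteq> {}"
    and "G = graph_link n Gs x y"
  shows "ABC_GG G <
    (real (card (edges G)) - (real n - 1))
    + (\<Sum>i=1..n. ABC_GG (Gs i))
    + (\<Sum>i=1..n-1. sqrt ((real (card (verts G)) - 2)
        / ((\<Sum>t=1..i. real (card (verts (Gs t)))) * (\<Sum>t=i+1..n. real (card (verts (Gs t)))))))"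
proof -
  note n = assms(1) and simple = assms(2) and disj = assms(4) and xy = assms(5) and G = assms(7)
  have finV: "finite (verts (Gs i))" if "i \<in> {1..n}" for i
    using simple[OF that] by (simp add: simple_graph_def)
  have same_part: "i = j" if "a \<in> verts (Gs i)" "a \<in> verts (Gs j)" "i \<in> {1..n}" "j \<in> {1..n}" for a i j
    using disj that unfolding disjoint_family_on_def by blast
  have sub: "e \<subseteq> verts (Gs i) \<and> card e = 2" if "e \<in> edges (Gs i)" "i \<in> {1..n}" for e i
    using simple[OF that(2)] that(1) by (simp add: simple_graph_def)
  have xv: "x i \<in> verts (Gs i)" and yv: "y i \<in> verts (Gs i)" if "i \<in> {1..n}" for i
    using xy[OF that] by auto
  define I where "I = (\<Union>i\<in>{1..n}. edges (Gs i))"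
  define bridge where "bridge i = {y i, x (i + 1)}" for i
  have E: "edges G = I \<union> bridge ` {1..n - 1}"
    unfolding G edges_graph_link I_def bridge_def ..
  have finI: "finite I" unfolding I_def using simple simple_graph_finite_edges by blast
  have ends: "y i \<in> verts (Gs i)" "x (i + 1) \<in> verts (Gs (i + 1))" "i \<in> {1..n}" "i + 1 \<in> {1..n}"
    if "i \<in> {1..n - 1}" for i
    using xv[of "i + 1"] yv[of i] that by auto
  have inj: "inj_on bridge {1..n - 1}"
  proof (rule inj_onI)
    fix i j assume i: "i \<in> {1..n - 1}" and j: "j \<in> {1..n - 1}" and eq: "bridge i = bridge j"
    have "y i = y j \<or> y i = x (j + 1) \<and> x (i + 1) = y j"
      using eq by (auto simp: bridge_def doubleton_eq_iff)
    then show "i = j"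
    proof
      assume "y i = y j"
      then show ?thesis using same_part[of "y i" i j] ends[OF i] ends[OF j] by simp
    next
      assume "y i = x (j + 1) \<and> x (i + 1) = y j"
      then have "i = j + 1" "i + 1 = j"
        using same_part[of "y i" i "j + 1"] same_part[of "y j" "i + 1" j] ends[OF i] ends[OF j]
        by simp_all
      then show ?thesis by simp
    qed
  qed
  have disjE: "I \<inter> bridge ` {1..n - 1} = {}"
  proof (rule ccontr)
    assume "I \<inter> bridge ` {1..n - 1} \<noteq> {}"
    then obtain i k where i: "i \<in> {1..n - 1}" and k: "k \<in> {1..n}" and e: "bridge i \<in> edges (Gs k)"
      unfolding I_def by blast
    have "y i \<in> verts (Gs k)" "x (i + 1) \<in> verts (Gs k)"
      using sub[OF e k] by (auto simp: bridge_def)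
    then have "i = k" "i + 1 = k"
      using same_part[of "y i" i k] same_part[of "x (i + 1)" "i + 1" k] ends[OF i] k by simp_all
    then show False by simp
  qed
  have cardE: "real (card I) = real (card (edges G)) - (real n - 1)"
    using n card_Un_disjoint[OF finI _ disjE] card_image[OF inj] unfolding E by simp
  have cardU: "real (card (\<Union>t\<in>T. verts (Gs t))) = (\<Sum>t\<in>T. real (card (verts (Gs t))))"
    if "T \<subseteq> {1..n}" for T
    using that disj finV finite_subset[OF that]
    by (subst card_UN_disjoint) (auto simp: disjoint_family_on_def subset_iff)

  have bridge_weight: "gg_weight G (bridge i) = sqrt ((real (card (verts G)) - 2)
        / ((\<Sum>t=1..i. real (card (verts (Gs t)))) * (\<Sum>t=i+1..n. real (card (verts (Gs t))))))"
    if i: "i \<in> {1..n - 1}" for i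
  proof -
    define L R where "L = (\<Union>t\<in>{1..i}. verts (Gs t))" and "R = (\<Union>t\<in>{i+1..n}. verts (Gs t))"
    have idx: "{1..n} = {1..i} \<union> {i+1..n}" using i by auto
    have V: "verts G = L \<union> R" unfolding G verts_graph_link L_def R_def idx by blast
    have LR: "L \<inter> R = {}"
      unfolding L_def R_def using i by (fastforce dest: same_part)
    have side: "t \<in> {1..i}" if a: "a \<in> L" and t: "a \<in> verts (Gs t)" "t \<in> {1..n}" for a t
    proof -
      obtain s where s: "s \<in> {1..i}" "a \<in> verts (Gs s)" using a unfolding L_def by blast
      then have "s = t" using same_part[OF s(2) t(1) _ t(2)] i by auto
      then show ?thesis using s(1) by simp
    qed
    have side': "t \<in> {i+1..n}" if a: "a \<in> R" and t: "a \<in> verts (Gs t)" "t \<in> {1..n}" for a t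
    proof -
      obtain s where s: "s \<in> {i+1..n}" "a \<in> verts (Gs s)" using a unfolding R_def by blast
      then have "s = t" using same_part[OF s(2) t(1) _ t(2)] by auto
      then show ?thesis using s(1) by simp
    qed
    have uv: "y i \<in> L" "x (i + 1) \<in> R" using ends[OF i] i by (auto simp: L_def R_def)
    (* An edge inside a part stays on one side, and the j-th linking edge steps from part j to
       part j + 1, so it changes sides only for j = i. *)
    have cut: "a = y i \<and> b = x (i + 1)" if a: "a \<in> L" and b: "b \<in> R" and ab: "{a, b} \<in> edges G" for a b
    proof -
      consider k where "k \<in> {1..n}" "{a, b} \<in> edges (Gs k)"
        | j where "j \<in> {1..n - 1}" "{a, b} = bridge j"
        using ab unfolding E I_def by blast
      then show ?thesis
      proof cases
        case 1
        then have "k \<in> {1..i}" "k \<in> {i+1..n}"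
          using sub[OF 1(2,1)] side[OF a] side'[OF b] by blast+
        then show ?thesis by simp
      next
        case 2
        note e = ends[OF 2(1)]
        from 2(2) consider "a = y j" "b = x (j + 1)" | "a = x (j + 1)" "b = y j"
          by (auto simp: bridge_def doubleton_eq_iff)
        then show ?thesis
        proof cases
          case 1
          then have "j \<le> i" "i + 1 \<le> j + 1"
            using side[OF a, of j] side'[OF b, of "j + 1"] e by auto
          then show ?thesis using 1 by simp
        next
          case 2
          then have "j + 1 \<le> i" "i + 1 \<le> j"
            using side[OF a, of "j + 1"] side'[OF b, of j] e by auto
          then show ?thesis by simp
        qed
      qed
    qed
    have "connected_graph G" unfolding G using assms(1,3,5) by (rule connected_graph_link)
    note closer = n_closer_bridge[OF cut V LR uv this]
    have "finite L" "finite R" using finV i by (auto simp: L_def R_def)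
    then have "real (card (verts G)) = real (card L) + real (card R)"
      unfolding V using LR by (simp add: card_Un_disjoint)
    moreover have "real (card L) = (\<Sum>t=1..i. real (card (verts (Gs t))))"
      unfolding L_def using i by (intro cardU) auto
    moreover have "real (card R) = (\<Sum>t=i+1..n. real (card (verts (Gs t))))"
      unfolding R_def using i by (intro cardU) auto
    ultimately show ?thesis by (simp only: bridge_def gg_weight_edge closer)
  qed

  have "ABC_GG G = (\<Sum>e\<in>I. gg_weight G e) + (\<Sum>i=1..n-1. gg_weight G (bridge i))"
    unfolding ABC_GG_def E using finI disjE inj
    by (simp add: sum.union_disjoint sum.reindex)
  also have "(\<Sum>e\<in>I. gg_weight G e) < (\<Sum>e\<in>I. 1)"
  proof (rule sum_strict_mono[OF finI])
    show "I \<noteq> {}" using assms(6) by (auto simp: I_def)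
    show "gg_weight G e < 1" if "e \<in> I" for e
      using that sub gg_weight_bounds(2) unfolding I_def by blast
  qed
  also have "(\<Sum>e\<in>I. 1) \<le> real (card I) + (\<Sum>i=1..n. ABC_GG (Gs i))"
    using sum_nonneg[of "{1..n}" "\<lambda>i. ABC_GG (Gs i)"] ABC_GG_nonneg[OF simple] by simp
  finally show ?thesis
    unfolding cardE by (simp only: bridge_weight cong: sum.cong)
qed

end
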